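(* Let $\mathcal K$ be a Cartesian category. The pseudo double category $\mathbf{Mly}(\mathcal K)$ has products and equalizers, and hence it has all tightly discrete limits, provided $\mathcal K$ admits limits; it does not admit tabulators.
   Context: For $\mathcal K$ a Cartesian category (finite products), $\mathbf{Mly}(\mathcal K)$ is the following pseudo double category of $\mathcal K$-valued Mealy automata. Objects and tight morphisms are those of $\mathcal K$. A loose morphism $A\nrightarrow B$ is a triple $(E,d,s)$ with $E$ an object (the carrier) and $d:A\times E\to E$, $s:A\times E\to B$ morphisms of $\mathcal K$. A cell from $(E,d,s):A\nrightarrow B$ to $(E',d',s'):X\nrightarrow Y$ with left side $f:A\to X$ and right side $g:B\to Y$ is a morphism $\alpha:E\to E'$ with $\alpha\circ d=d'\circ(f\times\alpha)$ and $g\circ s=s'\circ(f\times\alpha)$. The loose identity $\iota_A:A\nrightarrow A$ has carrier the terminal object $1$ and output map the projection $A\times 1\to A$. Vertical composition of cells is composition in $\mathcal K$. Every tight $f:A\to B$ induces the identity cell $\iota_f:\iota_A\Rightarrow\iota_B$, given by $\mathrm{id}_1$, with both sides $f$. Limits are small. A tightly discrete limit of a functor $D:J\to\mathcal K$ is an object $L$ with a cone $(p_j:L\to D_j)_j$ such that: (a) it is a limit cone in $\mathcal K$; (b) for every loose morphism $u:U\nrightarrow V$, every pair of cones $(a_j:U\to D_j)$, $(a'_j:V\to D_j)$ over $D$, and every family of cells $\xi_j:u\Rightarrow\iota_{D_j}$ with left side $a_j$ and right side $a'_j$ such that $\iota_{D(k)}\circ\xi_j=\xi_{j'}$ for all $k:j\to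 j'$ in $J$, there is a unique cell $\xi:u\Rightarrow\iota_L$, with sides the induced morphisms $U\to L$ and $V\to L$, such that $\iota_{p_j}\circ\xi=\xi_j$ for all $j$. Products and equalizers are the cases of $J$ discrete and $J$ a parallel pair. A tabulator of a loose morphism $F:A\nrightarrow B$ is an object $T$ with a cell $\varpi:\iota_T\Rightarrow F$ (with sides some $a:T\to A$, $b:T\to B$) such that for every cell $\xi:\iota_X\Rightarrow F$ with sides $p:X\to A$, $q:X\to B$, there is a unique tight morphism $h:X\to T$ with $ah=p$, $bh=q$ and $\varpi\circ\iota_h=\xi$.
   Formalization: "Does not admit tabulators" is proved when the terminal object of K is not initial; as stated it is false, e.g. for the terminal category, or any pointed K with equalizers (abelian groups), where Mly(K) has all tabulators. *)

theory Defs
  imports Main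
begin

section \<open>Categories, functors and limits\<close>

record ('o, 'm) cat =
  Obj :: "'o set"
  Arr :: "'m set"
  Dom :: "'m \<Rightarrow> 'o"
  Cod :: "'m \<Rightarrow> 'o"
  Ident :: "'o \<Rightarrow> 'm"
  Comp :: "'m \<Rightarrow> 'm \<Rightarrow> 'm"

text \<open>\<open>Comp C g f\<close> is the composite written \<open>g \<circ> f\<close> (first \<open>f\<close>, then \<open>g\<close>).\<close>

definition hom :: "('o, 'm, 'z) cat_scheme \<Rightarrow> 'o \<Rightarrow> 'o \<Rightarrow> 'm set" where
  "hom C a b = {f \<in> Arr C. Dom C f = a \<and> Cod C f = b}"

locale category =
  fixes C :: "('o, 'm, 'z) cat_scheme"
  assumes Dom_closed: "f \<in> Arr C \<Longrightarrow> Dom C f \<in> Obj C"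
    and Cod_closed: "f \<in> Arr C \<Longrightarrow> Cod C f \<in> Obj C"
    and Ident_closed: "a \<in> Obj C \<Longrightarrow> Ident C a \<in> hom C a a"
    and Comp_closed: "f \<in> hom C a b \<Longrightarrow> g \<in> hom C b c \<Longrightarrow> Comp C g f \<in> hom C a c"
    and Comp_Ident_left: "f \<in> hom C a b \<Longrightarrow> Comp C (Ident C b) f = f"
    and Comp_Ident_right: "f \<in> hom C a b \<Longrightarrow> Comp C f (Ident C a) = f"
    and Comp_assoc: "f \<in> hom C a b \<Longrightarrow> g \<in> hom C b c \<Longrightarrow> h \<in> hom C c d \<Longrightarrow>
      Comp C h (Comp C g f) = Comp C (Comp C h g) f"

definition is_functor ::
  "('i, 'j, 'y) cat_scheme \<Rightarrow> ('o, 'm, 'z) cat_scheme \<Rightarrow> ('i \<Rightarrow> 'o) \<Rightarrow> ('j \<Rightarrow> 'm) \<Rightarrow> bool" where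
  "is_functor J C Fo Fm \<longleftrightarrow>
     (\<forall>j \<in> Obj J. Fo j \<in> Obj C \<and> Fm (Ident J j) = Ident C (Fo j)) \<and>
     (\<forall>k \<in> Arr J. Fm k \<in> hom C (Fo (Dom J k)) (Fo (Cod J k))) \<and>
     (\<forall>k \<in> Arr J. \<forall>l \<in> Arr J. Cod J k = Dom J l \<longrightarrow>
        Fm (Comp J l k) = Comp C (Fm l) (Fm k))"

definition is_cone ::
  "('i, 'j, 'y) cat_scheme \<Rightarrow> ('o, 'm, 'z) cat_scheme \<Rightarrow> ('i \<Rightarrow> 'o) \<Rightarrow> ('j \<Rightarrow> 'm) \<Rightarrow>
    'o \<Rightarrow> ('i \<Rightarrow> 'm) \<Rightarrow> bool" where
  "is_cone J C Fo Fm U a \<longleftrightarrow>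
     U \<in> Obj C \<and> (\<forall>j \<in> Obj J. a j \<in> hom C U (Fo j)) \<and>
     (\<forall>k \<in> Arr J. Comp C (Fm k) (a (Dom J k)) = a (Cod J k))"

definition is_limit_cone ::
  "('i, 'j, 'y) cat_scheme \<Rightarrow> ('o, 'm, 'z) cat_scheme \<Rightarrow> ('i \<Rightarrow> 'o) \<Rightarrow> ('j \<Rightarrow> 'm) \<Rightarrow>
    'o \<Rightarrow> ('i \<Rightarrow> 'm) \<Rightarrow> bool" where
  "is_limit_cone J C Fo Fm L p \<longleftrightarrow>
     is_cone J C Fo Fm L p \<and>
     (\<forall>U a. is_cone J C Fo Fm U a \<longrightarrow>
        (\<exists>!h. h \<in> hom C U L \<and> (\<forall>j \<in> Obj J. Comp C (p j) h = a j)))"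

definition induced ::
  "('i, 'j, 'y) cat_scheme \<Rightarrow> ('o, 'm, 'z) cat_scheme \<Rightarrow> 'o \<Rightarrow> ('i \<Rightarrow> 'm) \<Rightarrow>
    'o \<Rightarrow> ('i \<Rightarrow> 'm) \<Rightarrow> 'm" where
  "induced J C L p U a = (THE h. h \<in> hom C U L \<and> (\<forall>j \<in> Obj J. Comp C (p j) h = a j))"

text \<open>
  Smallness is relative to a type \<open>'i\<close>: a category is small if its objects and its arrows
  are elements of \<open>'i\<close>. As \<open>'i\<close> is arbitrary, this covers any bound on the size of diagrams.
\<close>

definition has_limits :: "'i itself \<Rightarrow> ('o, 'm, 'z) cat_scheme \<Rightarrow> bool" where
  "has_limits _ C \<longleftrightarrow>
     (\<forall>(J :: ('i, 'i) cat) Fo Fm. category J \<longrightarrow> is_functor J C Fo Fm \<longrightarrow>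
        (\<exists>L p. is_limit_cone J C Fo Fm L p))"

definition is_initial :: "('o, 'm, 'z) cat_scheme \<Rightarrow> 'o \<Rightarrow> bool" where
  "is_initial C z \<longleftrightarrow> z \<in> Obj C \<and> (\<forall>a \<in> Obj C. \<exists>!f. f \<in> hom C z a)"

definition discrete_cat :: "'i set \<Rightarrow> ('i, 'i) cat" where
  "discrete_cat I = \<lparr>Obj = I, Arr = I, Dom = (\<lambda>k. k), Cod = (\<lambda>k. k),
     Ident = (\<lambda>j. j), Comp = (\<lambda>l k. k)\<rparr>"

datatype pp_obj = Source | Target

datatype pp_arr = Id_Source | Id_Target | First | Second

definition parallel_pair :: "(pp_obj, pp_arr) cat" where
  "parallel_pair = \<lparr>Obj = UNIV, Arr = UNIV,
     Dom = (\<lambda>k. if k = Id_Target then Target else Source),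
     Cod = (\<lambda>k. if k = Id_Source then Source else Target),
     Ident = (\<lambda>j. if j = Source then Id_Source else Id_Target),
     Comp = (\<lambda>l k. if k = Id_Source then l else k)\<rparr>"


section \<open>Cartesian categories\<close>

record ('o, 'm) cart = "('o, 'm) cat" +
  One :: "'o"
  Prd :: "'o \<Rightarrow> 'o \<Rightarrow> 'o"
  Fst :: "'o \<Rightarrow> 'o \<Rightarrow> 'm"
  Snd :: "'o \<Rightarrow> 'o \<Rightarrow> 'm"

locale cartesian_category = category K for K :: "('o, 'm, 'z) cart_scheme" +
  assumes One_closed: "One K \<in> Obj K"
    and One_terminal: "a \<in> Obj K \<Longrightarrow> \<exists>!f. f \<in> hom K a (One K)"
    and Prd_closed: "a \<in> Obj K \<Longrightarrow> b \<in> Obj K \<Longrightarrow> Prd K a b \<in> Obj K"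
    and Fst_closed: "a \<in> Obj K \<Longrightarrow> b \<in> Obj K \<Longrightarrow> Fst K a b \<in> hom K (Prd K a b) a"
    and Snd_closed: "a \<in> Obj K \<Longrightarrow> b \<in> Obj K \<Longrightarrow> Snd K a b \<in> hom K (Prd K a b) b"
    and Prd_universal: "a \<in> Obj K \<Longrightarrow> b \<in> Obj K \<Longrightarrow> f \<in> hom K c a \<Longrightarrow> g \<in> hom K c b \<Longrightarrow>
      \<exists>!h. h \<in> hom K c (Prd K a b) \<and> Comp K (Fst K a b) h = f \<and> Comp K (Snd K a b) h = g"

definition prod_map :: "('o, 'm, 'z) cart_scheme \<Rightarrow> 'm \<Rightarrow> 'm \<Rightarrow> 'm" where
  "prod_map K f g =
     (let a = Dom K f; a' = Cod K f; b = Dom K g; b' = Cod K g in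
      THE h. h \<in> hom K (Prd K a b) (Prd K a' b') \<and>
        Comp K (Fst K a' b') h = Comp K f (Fst K a b) \<and>
        Comp K (Snd K a' b') h = Comp K g (Snd K a b))"


section \<open>Double-categorical limits\<close>

text \<open>
  The part of a pseudo double category on which tightly discrete limits and tabulators depend:
  the tight category (the record being extended), loose morphisms, cells, vertical composition
  of cells and loose identities. Composition of loose morphisms and its coherence cells do not
  occur in these universal properties and are left out. \<open>Cell D u f g v\<close> is the set of cells
  from \<open>u\<close> to \<open>v\<close> with left side \<open>f\<close> and right side \<open>g\<close>; a cell is thus always considered
  together with its boundary.
\<close>

record ('o, 'm, 'l, 'c) dbl = "('o, 'm) cat" +
  Loose :: "'l set"
  LDom :: "'l \<Rightarrow> 'o"
  LCod :: "'l \<Rightarrow> 'o"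
  Cell :: "'l \<Rightarrow> 'm \<Rightarrow> 'm \<Rightarrow> 'l \<Rightarrow> 'c set"
  VComp :: "'c \<Rightarrow> 'c \<Rightarrow> 'c"
  LId :: "'o \<Rightarrow> 'l"
  LIdCell :: "'m \<Rightarrow> 'c"

definition is_tightly_discrete_limit ::
  "('i, 'j, 'y) cat_scheme \<Rightarrow> ('o, 'm, 'l, 'c, 'z) dbl_scheme \<Rightarrow> ('i \<Rightarrow> 'o) \<Rightarrow> ('j \<Rightarrow> 'm) \<Rightarrow>
    'o \<Rightarrow> ('i \<Rightarrow> 'm) \<Rightarrow> bool" where
  "is_tightly_discrete_limit J D Fo Fm L p \<longleftrightarrow>
     is_limit_cone J D Fo Fm L p \<and>
     (\<forall>u a a' \<xi>.
        u \<in> Loose D \<longrightarrow>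
        is_cone J D Fo Fm (LDom D u) a \<longrightarrow>
        is_cone J D Fo Fm (LCod D u) a' \<longrightarrow>
        (\<forall>j \<in> Obj J. \<xi> j \<in> Cell D u (a j) (a' j) (LId D (Fo j))) \<longrightarrow>
        (\<forall>k \<in> Arr J. VComp D (LIdCell D (Fm k)) (\<xi> (Dom J k)) = \<xi> (Cod J k)) \<longrightarrow>
        (\<exists>!x. x \<in> Cell D u (induced J D L p (LDom D u) a) (induced J D L p (LCod D u) a') (LId D L) \<and>
              (\<forall>j \<in> Obj J. VComp D (LIdCell D (p j)) x = \<xi> j)))"

definition has_tightly_discrete_limits_of_shape ::
  "('i, 'j, 'y) cat_scheme \<Rightarrow> ('o, 'm, 'l, 'c, 'z) dbl_scheme \<Rightarrow> bool" where
  "has_tightly_discrete_limits_of_shape J D \<longleftrightarrow>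
     (\<forall>Fo Fm. is_functor J D Fo Fm \<longrightarrow> (\<exists>L p. is_tightly_discrete_limit J D Fo Fm L p))"

definition has_double_products :: "'i itself \<Rightarrow> ('o, 'm, 'l, 'c, 'z) dbl_scheme \<Rightarrow> bool" where
  "has_double_products _ D \<longleftrightarrow>
     (\<forall>I :: 'i set. has_tightly_discrete_limits_of_shape (discrete_cat I) D)"

definition has_double_equalizers :: "('o, 'm, 'l, 'c, 'z) dbl_scheme \<Rightarrow> bool" where
  "has_double_equalizers D \<longleftrightarrow> has_tightly_discrete_limits_of_shape parallel_pair D"

definition has_tightly_discrete_limits ::
  "'i itself \<Rightarrow> ('o, 'm, 'l, 'c, 'z) dbl_scheme \<Rightarrow> bool" where
  "has_tightly_discrete_limits _ D \<longleftrightarrow>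
     (\<forall>J :: ('i, 'i) cat. category J \<longrightarrow> has_tightly_discrete_limits_of_shape J D)"

definition is_tabulator ::
  "('o, 'm, 'l, 'c, 'z) dbl_scheme \<Rightarrow> 'l \<Rightarrow> 'o \<Rightarrow> 'm \<Rightarrow> 'm \<Rightarrow> 'c \<Rightarrow> bool" where
  "is_tabulator D F T a b w \<longleftrightarrow>
     T \<in> Obj D \<and> a \<in> hom D T (LDom D F) \<and> b \<in> hom D T (LCod D F) \<and>
     w \<in> Cell D (LId D T) a b F \<and>
     (\<forall>X \<in> Obj D. \<forall>p \<in> hom D X (LDom D F). \<forall>q \<in> hom D X (LCod D F).
        \<forall>\<xi> \<in> Cell D (LId D X) p q F.
          \<exists>!h. h \<in> hom D X T \<and> Comp D a h = p \<and> Comp D b h = q \<and>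
               VComp D w (LIdCell D h) = \<xi>)"

definition has_tabulators :: "('o, 'm, 'l, 'c, 'z) dbl_scheme \<Rightarrow> bool" where
  "has_tabulators D \<longleftrightarrow> (\<forall>F \<in> Loose D. \<exists>T a b w. is_tabulator D F T a b w)"


section \<open>Mealy automata\<close>

record ('o, 'm) mealy =
  Inp :: "'o"
  Outp :: "'o"
  Carrier :: "'o"
  Trans :: "'m"
  Output :: "'m"

definition mealy_automata :: "('o, 'm, 'z) cart_scheme \<Rightarrow> ('o, 'm) mealy set" where
  "mealy_automata K =
     {M. Inp M \<in> Obj K \<and> Outp M \<in> Obj K \<and> Carrier M \<in> Obj K \<and>
         Trans M \<in> hom K (Prd K (Inp M) (Carrier M)) (Carrier M) \<and>
         Output M \<in> hom K (Prd K (Inp M) (Carrier M)) (Outp M)}"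

definition mealy_cell ::
  "('o, 'm, 'z) cart_scheme \<Rightarrow> ('o, 'm) mealy \<Rightarrow> 'm \<Rightarrow> 'm \<Rightarrow> ('o, 'm) mealy \<Rightarrow> 'm set" where
  "mealy_cell K M f g N =
     {\<alpha>. M \<in> mealy_automata K \<and> N \<in> mealy_automata K \<and>
         f \<in> hom K (Inp M) (Inp N) \<and> g \<in> hom K (Outp M) (Outp N) \<and>
         \<alpha> \<in> hom K (Carrier M) (Carrier N) \<and>
         Comp K \<alpha> (Trans M) = Comp K (Trans N) (prod_map K f \<alpha>) \<and>
         Comp K g (Output M) = Comp K (Output N) (prod_map K f \<alpha>)}"

text \<open>The transition map of an identity is the unique map \<open>A \<times> 1 \<rightarrow> 1\<close>, i.e. the second projection.\<close>

definition mealy_id :: "('o, 'm, 'z) cart_scheme \<Rightarrow> 'o \<Rightarrow> ('o, 'm) mealy" where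
  "mealy_id K A = \<lparr>Inp = A, Outp = A, Carrier = One K,
     Trans = Snd K A (One K), Output = Fst K A (One K)\<rparr>"

definition Mly :: "('o, 'm, 'z) cart_scheme \<Rightarrow> ('o, 'm, ('o, 'm) mealy, 'm) dbl" where
  "Mly K = \<lparr>Obj = Obj K, Arr = Arr K, Dom = Dom K, Cod = Cod K, Ident = Ident K, Comp = Comp K,
     Loose = mealy_automata K, LDom = Inp, LCod = Outp,
     Cell = mealy_cell K, VComp = Comp K,
     LId = mealy_id K, LIdCell = (\<lambda>f. Ident K (One K))\<rparr>"

end

theory Submission
  imports Defs
begin

text \<open>
  A cell into a loose identity \<open>\<iota>\<^bsub>L\<^esub>\<close> is a map into the terminal object, so it is
  unique as soon as it exists, and it exists iff its sides satisfy one equation between maps into \<open>L\<close>.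
  When \<open>L\<close> is a limit in the base, that equation can be tested after composing with the
  projections, so every limit cone is a tightly discrete limit.

  A cell \<open>\<iota>\<^bsub>X\<^esub> \<Rightarrow> F\<close> is in particular a point of the carrier of \<open>F\<close>, and
  pasting with an identity cell does not change that point: if \<open>F\<close> has a tabulator, then exactly
  one point underlies a cell from a loose identity. On the automaton \<open>1 \<nrightarrow> 1\<close> with carrier
  \<open>A\<close> and with the identity as transition, every point of \<open>A\<close> underlies such a cell. If
  all tabulators exist, then each \<open>A\<close> has exactly one point, that is, \<open>1\<close> is initial.
\<close>

section \<open>Limits in ordinary categories and transport along a renaming of the shape\<close>

lemma homD:
  assumes "f \<in> hom C a b"
  shows "f \<in> Arr C" "Dom C f = a" "Cod C f = b"
  using assms by (auto simp: hom_def)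

lemma (in category) hom_objects:
  assumes "f \<in> hom C a b"
  shows "a \<in> Obj C" "b \<in> Obj C"
  using assms Dom_closed Cod_closed by (auto simp: hom_def)

lemma is_limit_coneD:
  assumes "is_limit_cone J C Fo Fm L p" and "is_cone J C Fo Fm U a"
  shows "induced J C L p U a \<in> hom C U L"
    and "\<And>j. j \<in> Obj J \<Longrightarrow> Comp C (p j) (induced J C L p U a) = a j"
proof -
  have "\<exists>!h. h \<in> hom C U L \<and> (\<forall>j \<in> Obj J. Comp C (p j) h = a j)"
    using assms by (simp add: is_limit_cone_def)
  from theI'[OF this]
  show "induced J C L p U a \<in> hom C U L"
    and "\<And>j. j \<in> Obj J \<Longrightarrow> Comp C (p j) (induced J C L p U a) = a j"
    by (auto simp: induced_def)
qed

text \<open>Composing the projections with \<open>f\<close> gives a cone on \<open>U\<close>, and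
  both \<open>f\<close> and \<open>g\<close> mediate it.\<close>

lemma (in category) limit_cone_jointly_monic:
  assumes lim: "is_limit_cone J C Fo Fm L p"
    and J: "category J" and Fm: "\<And>k. k \<in> Arr J \<Longrightarrow> Fm k \<in> hom C (Fo (Dom J k)) (Fo (Cod J k))"
    and f: "f \<in> hom C U L" and g: "g \<in> hom C U L"
    and eq: "\<And>j. j \<in> Obj J \<Longrightarrow> Comp C (p j) f = Comp C (p j) g"
  shows "f = g"
proof -
  have cone: "is_cone J C Fo Fm L p"
    using lim by (simp add: is_limit_cone_def)
  have p: "p j \<in> hom C L (Fo j)" if "j \<in> Obj J" for j
    using cone that by (simp add: is_cone_def)
  have "is_cone J C Fo Fm U (\<lambda>j. Comp C (p j) f)"
    unfolding is_cone_def
  proof (intro conjI ballI)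
    show "U \<in> Obj C" using hom_objects[OF f] by simp
    show "Comp C (p j) f \<in> hom C U (Fo j)" if "j \<in> Obj J" for j
      using Comp_closed[OF f p[OF that]] .
    show "Comp C (Fm k) (Comp C (p (Dom J k)) f) = Comp C (p (Cod J k)) f" if "k \<in> Arr J" for k
      using Comp_assoc[OF f p[OF category.Dom_closed[OF J that]] Fm[OF that]] cone that
      by (simp add: is_cone_def)
  qed
  then have "\<exists>!h. h \<in> hom C U L \<and> (\<forall>j \<in> Obj J. Comp C (p j) h = Comp C (p j) f)"
    using lim by (simp add: is_limit_cone_def)
  then show ?thesis
    using f g eq by (metis (no_types, lifting))
qed

text \<open>\<open>has_limits\<close> speaks only of shapes whose objects and arrows lie in the one
  type \<open>'i\<close>. A shape over other types, such as \<open>parallel_pair\<close>, has to be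
  copied into \<open>'i\<close> first.\<close>

lemma has_limits_of_embedded_shape:
  fixes J :: "('a, 'b) cat" and e :: "'a \<Rightarrow> 'i" and e' :: "'b \<Rightarrow> 'i"
  assumes lim: "has_limits TYPE('i) C" and J: "category J"
    and e: "inj e" and e': "inj e'" and F: "is_functor J C Fo Fm"
  shows "\<exists>L p. is_limit_cone J C Fo Fm L p"
proof -
  \<comment> \<open>An isomorphic copy of \<open>J\<close>, with objects renamed along
    \<open>e\<close> and arrows along \<open>e'\<close>.\<close>
  define J' :: "('i, 'i) cat" where
    "J' = \<lparr>Obj = e ` Obj J, Arr = e' ` Arr J, Dom = (\<lambda>k. e (Dom J (inv e' k))),
       Cod = (\<lambda>k. e (Cod J (inv e' k))), Ident = (\<lambda>j. e' (Ident J (inv e j))),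
       Comp = (\<lambda>l k. e' (Comp J (inv e' l) (inv e' k)))\<rparr>"
  have homJ': "k \<in> hom J' x y \<longleftrightarrow> (\<exists>k0 a b. k = e' k0 \<and> x = e a \<and> y = e b \<and> k0 \<in> hom J a b)"
    for k x y
    using e e' by (auto simp: hom_def J'_def)
  then have homJ'I: "e' k \<in> hom J' (e a) (e b)" if "k \<in> hom J a b" for k a b
    using that by blast
  \<comment> \<open>With the source already written as \<open>e a\<close>, injectivity fixes
    \<open>a\<close>. Composable arrows of \<open>J'\<close> can thus be lifted one after another to
    arrows of \<open>J\<close> that are again composable.\<close>
  have homJ'E: "\<exists>k0 b. k = e' k0 \<and> y = e b \<and> k0 \<in> hom J a b" if "k \<in> hom J' (e a) y" for k a y
    using that e by (auto simp: homJ' inj_eq)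
  have hom_dom: "\<exists>a. x = e a" if "k \<in> hom J' x y" for k x y
    using that by (auto simp: homJ')
  have Ident': "Ident J' (e j) = e' (Ident J j)" for j
    using e by (simp add: J'_def)
  have Comp': "Comp J' (e' l) (e' k) = e' (Comp J l k)" for l k
    using e' by (simp add: J'_def)
  have catJ': "category J'"
  proof
    show "Dom J' f \<in> Obj J'" if "f \<in> Arr J'" for f
      using that category.Dom_closed[OF J] e' by (auto simp: J'_def)
    show "Cod J' f \<in> Obj J'" if "f \<in> Arr J'" for f
      using that category.Cod_closed[OF J] e' by (auto simp: J'_def)
    show "Ident J' a \<in> hom J' a a" if *: "a \<in> Obj J'" for a
    proof -
      obtain a0 where "a0 \<in> Obj J" "a = e a0"
        using * by (auto simp: J'_def)
      then show ?thesis
        using category.Ident_closed[OF J \<open>a0 \<in> Obj J\<close>] by (simp add: Ident' homJ'I)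
    qed
    show "Comp J' g f \<in> hom J' a c" if *: "f \<in> hom J' a b" "g \<in> hom J' b c" for f g a b c
    proof -
      obtain a0 where "a = e a0"
        using hom_dom[OF *(1)] by blast
      with *(1) obtain f0 b0 where "f = e' f0" "b = e b0" "f0 \<in> hom J a0 b0"
        using homJ'E by blast
      with *(2) obtain g0 c0 where "g = e' g0" "c = e c0" "g0 \<in> hom J b0 c0"
        using homJ'E by blast
      with \<open>a = e a0\<close> \<open>f = e' f0\<close> show ?thesis
        using category.Comp_closed[OF J \<open>f0 \<in> hom J a0 b0\<close> \<open>g0 \<in> hom J b0 c0\<close>]
        by (simp add: Comp' homJ'I)
    qed
    show "Comp J' (Ident J' b) f = f" if *: "f \<in> hom J' a b" for f a b
    proof -
      obtain f0 a0 b0 where "f = e' f0" "b = e b0" "f0 \<in> hom J a0 b0"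
        using iffD1[OF homJ' *] by blast
      then show ?thesis
        using category.Comp_Ident_left[OF J \<open>f0 \<in> hom J a0 b0\<close>] by (simp add: Ident' Comp')
    qed
    show "Comp J' f (Ident J' a) = f" if *: "f \<in> hom J' a b" for f a b
    proof -
      obtain f0 a0 b0 where "f = e' f0" "a = e a0" "f0 \<in> hom J a0 b0"
        using iffD1[OF homJ' *] by blast
      then show ?thesis
        using category.Comp_Ident_right[OF J \<open>f0 \<in> hom J a0 b0\<close>] by (simp add: Ident' Comp')
    qed
    show "Comp J' h (Comp J' g f) = Comp J' (Comp J' h g) f"
      if *: "f \<in> hom J' a b" "g \<in> hom J' b c" "h \<in> hom J' c d" for f g h a b c d
    proof -
      obtain a0 where "a = e a0"
        using hom_dom[OF *(1)] by blast
      with *(1) obtain f0 b0 where "f = e' f0" "b = e b0" "f0 \<in> hom J a0 b0"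
        using homJ'E by blast
      with *(2) obtain g0 c0 where "g = e' g0" "c = e c0" "g0 \<in> hom J b0 c0"
        using homJ'E by blast
      with *(3) obtain h0 d0 where "h = e' h0" "h0 \<in> hom J c0 d0"
        using homJ'E by blast
      with \<open>f = e' f0\<close> \<open>g = e' g0\<close> show ?thesis
        using category.Comp_assoc[OF J \<open>f0 \<in> hom J a0 b0\<close> \<open>g0 \<in> hom J b0 c0\<close> \<open>h0 \<in> hom J c0 d0\<close>]
        by (simp add: Comp')
    qed
  qed
  have "is_functor J' C (Fo \<circ> inv e) (Fm \<circ> inv e')"
    using F e e' by (auto simp: is_functor_def J'_def inj_eq)
  then obtain L p where L: "is_limit_cone J' C (Fo \<circ> inv e) (Fm \<circ> inv e') L p"
    using lim catJ' unfolding has_limits_def by blast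
  have cone: "is_cone J' C (Fo \<circ> inv e) (Fm \<circ> inv e') U a \<longleftrightarrow> is_cone J C Fo Fm U (a \<circ> e)"
    for U a
    using e e' by (auto simp: is_cone_def J'_def)
  have "is_limit_cone J C Fo Fm L (p \<circ> e)"
    unfolding is_limit_cone_def
  proof (intro conjI allI impI)
    show "is_cone J C Fo Fm L (p \<circ> e)"
      using L cone by (simp add: is_limit_cone_def)
    fix U a assume "is_cone J C Fo Fm U a"
    \<comment> \<open>Rewriting \<open>a\<close> in this form lets \<open>cone\<close> be read from
      right to left, which makes \<open>a \<circ> inv e\<close> a cone over the copy.\<close>
    then have "is_cone J C Fo Fm U ((a \<circ> inv e) \<circ> e)"
      using e by (simp add: comp_assoc)
    then have "is_cone J' C (Fo \<circ> inv e) (Fm \<circ> inv e') U (a \<circ> inv e)"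
      by (simp only: cone)
    then have "\<exists>!h. h \<in> hom C U L \<and> (\<forall>j \<in> Obj J'. Comp C (p j) h = (a \<circ> inv e) j)"
      using L unfolding is_limit_cone_def by blast
    then show "\<exists>!h. h \<in> hom C U L \<and> (\<forall>j \<in> Obj J. Comp C ((p \<circ> e) j) h = a j)"
      using e by (simp add: J'_def)
  qed
  then show ?thesis by blast
qed

lemma category_discrete_cat: "category (discrete_cat I)"
  by unfold_locales (auto simp: discrete_cat_def hom_def)

lemma category_parallel_pair: "category parallel_pair"
proof -
  have "i = Source \<or> i = Target" for i
    by (cases i) auto
  then show ?thesis
    by unfold_locales (auto simp: parallel_pair_def hom_def split: if_splits)
qed

section \<open>Products of maps and cells into loose identities\<close>

context cartesian_category
begin

lemma
  assumes f: "f \<in> hom K a a'" and g: "g \<in> hom K b b'"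
  shows Fst_prod_map: "Comp K (Fst K a' b') (prod_map K f g) = Comp K f (Fst K a b)"
    and Snd_prod_map: "Comp K (Snd K a' b') (prod_map K f g) = Comp K g (Snd K a b)"
proof -
  note objs = hom_objects[OF f] hom_objects[OF g]
  have "\<exists>!h. h \<in> hom K (Prd K a b) (Prd K a' b') \<and>
      Comp K (Fst K a' b') h = Comp K f (Fst K a b) \<and>
      Comp K (Snd K a' b') h = Comp K g (Snd K a b)"
    using objs f g by (intro Prd_universal Comp_closed[OF Fst_closed] Comp_closed[OF Snd_closed])
  from theI'[OF this]
  show "Comp K (Fst K a' b') (prod_map K f g) = Comp K f (Fst K a b)"
    and "Comp K (Snd K a' b') (prod_map K f g) = Comp K g (Snd K a b)"
    using homD[OF f] homD[OF g] by (auto simp: prod_map_def Let_def)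
qed

lemma One_unique: "f \<in> hom K a (One K) \<Longrightarrow> g \<in> hom K a (One K) \<Longrightarrow> f = g"
  using One_terminal hom_objects(1) by blast

lemma mealy_id_closed: "a \<in> Obj K \<Longrightarrow> mealy_id K a \<in> mealy_automata K"
  by (simp add: mealy_automata_def mealy_id_def One_closed Fst_closed Snd_closed)

text \<open>The transition equation compares two maps into the terminal object, so it is automatic.
  In the output equation, the first projection after the product of \<open>f\<close> and
  \<open>x\<close> is \<open>f\<close> after the first projection, so \<open>x\<close> drops
  out.\<close>

lemma mealy_cell_to_id_iff:
  assumes "M \<in> mealy_automata K" "L \<in> Obj K"
    and "f \<in> hom K (Inp M) L" "g \<in> hom K (Outp M) L"
  shows "x \<in> mealy_cell K M f g (mealy_id K L) \<longleftrightarrow>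
    x \<in> hom K (Carrier M) (One K) \<and>
    Comp K g (Output M) = Comp K f (Fst K (Inp M) (Carrier M))"
proof -
  have d: "Trans M \<in> hom K (Prd K (Inp M) (Carrier M)) (Carrier M)"
    and objs: "Inp M \<in> Obj K" "Carrier M \<in> Obj K"
    using assms(1) by (auto simp: mealy_automata_def)
  have "Comp K x (Trans M) = Comp K x (Snd K (Inp M) (Carrier M))"
    if "x \<in> hom K (Carrier M) (One K)"
    using Comp_closed[OF d that] Comp_closed[OF Snd_closed that] objs by (intro One_unique)
  then show ?thesis
    using assms Fst_prod_map[OF assms(3), of x "Carrier M" "One K"]
      Snd_prod_map[OF assms(3), of x "Carrier M" "One K"] mealy_id_closed
    by (auto simp: mealy_cell_def mealy_id_def)
qed

section \<open>Tightly discrete limits in \<open>Mly K\<close>\<close>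

lemma hom_Mly: "hom (Mly K) = hom K"
  by (simp add: hom_def Mly_def fun_eq_iff)

lemma Mly_cat_simps:
  "is_functor J (Mly K) = is_functor J K"
  "is_cone J (Mly K) = is_cone J K"
  "is_limit_cone J (Mly K) = is_limit_cone J K"
  "induced J (Mly K) = induced J K"
proof -
  show cone: "is_cone J (Mly K) = is_cone J K"
    by (simp add: is_cone_def hom_Mly fun_eq_iff) (simp add: Mly_def)
  show "is_functor J (Mly K) = is_functor J K"
    by (simp add: is_functor_def hom_Mly fun_eq_iff) (simp add: Mly_def)
  show "is_limit_cone J (Mly K) = is_limit_cone J K"
    by (simp add: is_limit_cone_def hom_Mly cone fun_eq_iff) (simp add: Mly_def)
  show "induced J (Mly K) = induced J K"
    by (simp add: induced_def hom_Mly fun_eq_iff) (simp add: Mly_def)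
qed

lemma limit_cone_tightly_discrete:
  assumes J: "category J" and F: "is_functor J K Fo Fm" and lim: "is_limit_cone J K Fo Fm L p"
  shows "is_tightly_discrete_limit J (Mly K) Fo Fm L p"
  unfolding is_tightly_discrete_limit_def Mly_cat_simps
proof (intro conjI allI impI)
  show "is_limit_cone J K Fo Fm L p" by fact
  fix M a a' \<xi>
  assume "M \<in> Loose (Mly K)"
    and a: "is_cone J K Fo Fm (LDom (Mly K) M) a"
    and a': "is_cone J K Fo Fm (LCod (Mly K) M) a'"
    and \<xi>: "\<forall>j \<in> Obj J. \<xi> j \<in> Cell (Mly K) M (a j) (a' j) (LId (Mly K) (Fo j))"
  have sel: "LDom (Mly K) = Inp" "LCod (Mly K) = Outp" "Cell (Mly K) = mealy_cell K"
    "LId (Mly K) = mealy_id K" "VComp (Mly K) = Comp K" "LIdCell (Mly K) m = Ident K (One K)" for m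
    by (simp_all add: Mly_def)
  note a = a[unfolded sel] and a' = a'[unfolded sel] and \<xi> = \<xi>[unfolded sel]
  have M: "M \<in> mealy_automata K"
    using \<open>M \<in> Loose (Mly K)\<close> by (simp add: Mly_def)
  have s: "Output M \<in> hom K (Prd K (Inp M) (Carrier M)) (Outp M)"
    and objs: "Inp M \<in> Obj K" "Carrier M \<in> Obj K"
    using M by (auto simp: mealy_automata_def)
  have \<pi>: "Fst K (Inp M) (Carrier M) \<in> hom K (Prd K (Inp M) (Carrier M)) (Inp M)"
    using objs by (rule Fst_closed)
  define f where "f = induced J K L p (Inp M) a"
  define g where "g = induced J K L p (Outp M) a'"
  have f: "f \<in> hom K (Inp M) L" and g: "g \<in> hom K (Outp M) L"
    using is_limit_coneD(1)[OF lim] a a' by (auto simp: f_def g_def)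
  have pf: "Comp K (p j) f = a j" and pg: "Comp K (p j) g = a' j" if "j \<in> Obj J" for j
    using is_limit_coneD(2)[OF lim] a a' that by (auto simp: f_def g_def)
  have cone: "is_cone J K Fo Fm L p"
    using lim by (simp add: is_limit_cone_def)
  then have L: "L \<in> Obj K" and p: "\<And>j. j \<in> Obj J \<Longrightarrow> p j \<in> hom K L (Fo j)"
    by (auto simp: is_cone_def)
  have \<xi>j: "\<xi> j \<in> hom K (Carrier M) (One K)"
    "Comp K (a' j) (Output M) = Comp K (a j) (Fst K (Inp M) (Carrier M))"
    if j: "j \<in> Obj J" for j
  proof -
    have "Fo j \<in> Obj K" "a j \<in> hom K (Inp M) (Fo j)" "a' j \<in> hom K (Outp M) (Fo j)"
      using F a a' j by (auto simp: is_functor_def is_cone_def)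
    from mealy_cell_to_id_iff[OF M this, of "\<xi> j"] \<xi> j
    show "\<xi> j \<in> hom K (Carrier M) (One K)"
      "Comp K (a' j) (Output M) = Comp K (a j) (Fst K (Inp M) (Carrier M))"
      by auto
  qed
  \<comment> \<open>The existence condition for a cell into the identity on \<open>L\<close>, tested
    on each projection, where it becomes the condition already supplied by
    \<open>\<xi> j\<close>.\<close>
  have eq: "Comp K g (Output M) = Comp K f (Fst K (Inp M) (Carrier M))"
  proof (rule limit_cone_jointly_monic[OF lim J])
    show "Fm k \<in> hom K (Fo (Dom J k)) (Fo (Cod J k))" if "k \<in> Arr J" for k
      using F that by (simp add: is_functor_def)
    show "Comp K g (Output M) \<in> hom K (Prd K (Inp M) (Carrier M)) L"
      using s g by (rule Comp_closed)
    show "Comp K f (Fst K (Inp M) (Carrier M)) \<in> hom K (Prd K (Inp M) (Carrier M)) L"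
      using \<pi> f by (rule Comp_closed)
    show "Comp K (p j) (Comp K g (Output M)) = Comp K (p j) (Comp K f (Fst K (Inp M) (Carrier M)))"
      if j: "j \<in> Obj J" for j
      using Comp_assoc[OF s g p[OF j]] Comp_assoc[OF \<pi> f p[OF j]] pf[OF j] pg[OF j] \<xi>j(2)[OF j]
      by simp
  qed
  have cell: "x \<in> mealy_cell K M f g (mealy_id K L) \<longleftrightarrow> x \<in> hom K (Carrier M) (One K)" for x
    using mealy_cell_to_id_iff[OF M L f g] eq by simp
  \<comment> \<open>Both sides are maps from the carrier to \<open>One K\<close>, so the one
    candidate restricts to every \<open>\<xi> j\<close>.\<close>
  have comp: "Comp K (Ident K (One K)) x = \<xi> j"
    if "x \<in> hom K (Carrier M) (One K)" "j \<in> Obj J" for x j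
    using Comp_Ident_left[OF that(1)] One_unique[OF that(1) \<xi>j(1)[OF that(2)]] by simp
  have "\<exists>!x. x \<in> mealy_cell K M f g (mealy_id K L) \<and>
      (\<forall>j \<in> Obj J. Comp K (Ident K (One K)) x = \<xi> j)"
    using One_terminal[OF objs(2)] comp unfolding cell by blast
  then show "\<exists>!x. x \<in> Cell (Mly K) M (induced J K L p (LDom (Mly K) M) a)
          (induced J K L p (LCod (Mly K) M) a') (LId (Mly K) L) \<and>
        (\<forall>j \<in> Obj J. VComp (Mly K) (LIdCell (Mly K) (p j)) x = \<xi> j)"
    by (simp only: sel f_def g_def)
qed

lemma has_tightly_discrete_limits_of_embedded_shape:
  fixes J :: "('a, 'b) cat" and e :: "'a \<Rightarrow> 'i" and e' :: "'b \<Rightarrow> 'i"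
  assumes "has_limits TYPE('i) K" "category J" "inj e" "inj e'"
  shows "has_tightly_discrete_limits_of_shape J (Mly K)"
  using has_limits_of_embedded_shape[OF assms] limit_cone_tightly_discrete[OF assms(2)]
  unfolding has_tightly_discrete_limits_of_shape_def Mly_cat_simps by blast

section \<open>Tabulators and points of the carrier\<close>

lemma tabulator_cell_unique:
  assumes T: "is_tabulator (Mly K) F T a b w"
    and X: "X \<in> Obj K" and \<xi>: "\<xi> \<in> mealy_cell K (mealy_id K X) p q F"
  shows "\<xi> = w"
proof -
  have "p \<in> hom K X (Inp F)" "q \<in> hom K X (Outp F)"
    using \<xi> by (auto simp: mealy_cell_def mealy_id_def)
  \<comment> \<open>After unfolding, \<open>h\<close> no longer occurs in the last conjunct: pasting
    with an identity cell composes \<open>w\<close> with the identity of \<open>One K\<close>,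
    whatever \<open>h\<close> is.\<close>
  moreover have "\<forall>X \<in> Obj K. \<forall>p \<in> hom K X (Inp F). \<forall>q \<in> hom K X (Outp F).
      \<forall>\<xi> \<in> mealy_cell K (mealy_id K X) p q F. \<exists>!h. h \<in> hom K X T \<and>
        Comp K a h = p \<and> Comp K b h = q \<and> Comp K w (Ident K (One K)) = \<xi>"
    using T unfolding is_tabulator_def hom_Mly by (simp add: Mly_def)
  ultimately have "Comp K w (Ident K (One K)) = \<xi>"
    using X \<xi> by blast
  moreover have "w \<in> hom K (One K) (Carrier F)"
    using T by (auto simp: is_tabulator_def Mly_def mealy_cell_def mealy_id_def)
  ultimately show ?thesis
    using Comp_Ident_right by simp
qed

text \<open>A machine that never leaves its state. Input and output are terminal so that only the
  state carries information.\<close>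

definition idle :: "'o \<Rightarrow> ('o, 'm) mealy" where
  "idle A = \<lparr>Inp = One K, Outp = One K, Carrier = A,
     Trans = Snd K (One K) A, Output = Fst K (One K) A\<rparr>"

lemma idle_closed: "A \<in> Obj K \<Longrightarrow> idle A \<in> mealy_automata K"
  by (simp add: idle_def mealy_automata_def One_closed Fst_closed Snd_closed)

text \<open>Both cell equations are instances of naturality of the projections.\<close>

lemma mealy_cell_id_idle:
  assumes x: "x \<in> hom K (One K) A"
  shows "x \<in> mealy_cell K (mealy_id K (One K)) (Ident K (One K)) (Ident K (One K)) (idle A)"
  using x idle_closed[of A] hom_objects[OF x] mealy_id_closed[OF One_closed]
    Ident_closed[OF One_closed]
    Fst_prod_map[OF Ident_closed[OF One_closed] x] Snd_prod_map[OF Ident_closed[OF One_closed] x]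
  by (auto simp: mealy_cell_def mealy_id_def idle_def)

text \<open>Used in contrapositive form. Some condition on \<open>K\<close> is unavoidable for the
  negative claim: over the category with a single arrow, every loose morphism has a
  tabulator.\<close>

lemma has_tabulators_imp_initial:
  assumes "has_tabulators (Mly K)"
  shows "is_initial K (One K)"
  unfolding is_initial_def
proof (intro conjI ballI)
  show "One K \<in> Obj K" by (rule One_closed)
  fix A assume "A \<in> Obj K"
  then have "idle A \<in> Loose (Mly K)"
    by (simp add: idle_closed Mly_def)
  then obtain T a b w where T: "is_tabulator (Mly K) (idle A) T a b w"
    using assms by (auto simp: has_tabulators_def)
  \<comment> \<open>The tabulating cell is itself a point of \<open>A\<close>; this gives
    existence.\<close>
  have "w \<in> hom K (One K) A"
    using T by (auto simp: is_tabulator_def Mly_def mealy_cell_def mealy_id_def idle_def)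
  moreover have "x = w" if "x \<in> hom K (One K) A" for x
    using tabulator_cell_unique[OF T One_closed mealy_cell_id_idle[OF that]] .
  ultimately show "\<exists>!f. f \<in> hom K (One K) A" by blast
qed

end

theorem theorem27:
  fixes K :: "('o, 'm) cart"
  assumes "cartesian_category K"
    and "infinite (UNIV :: 'i set)"
  shows "(has_limits TYPE('i) K \<longrightarrow>
           has_double_products TYPE('i) (Mly K) \<and>
           has_double_equalizers (Mly K) \<and>
           has_tightly_discrete_limits TYPE('i) (Mly K)) \<and>
         (\<not> is_initial K (One K) \<longrightarrow> \<not> has_tabulators (Mly K))"
proof -
  interpret cartesian_category K by fact
  have all: "has_tightly_discrete_limits TYPE('i) (Mly K)" if "has_limits TYPE('i) K"
    unfolding has_tightly_discrete_limits_def
    using has_tightly_discrete_limits_of_embedded_shape[OF that _ inj_on_id inj_on_id] by blast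
  moreover have "has_double_products TYPE('i) (Mly K)" if "has_limits TYPE('i) K"
    using all[OF that] category_discrete_cat
    unfolding has_double_products_def has_tightly_discrete_limits_def by blast
  moreover have "has_double_equalizers (Mly K)" if lim: "has_limits TYPE('i) K"
  proof -
    \<comment> \<open>Infinity of \<open>'i\<close> provides distinct codes for the two objects and
      for the four arrows of the parallel pair. An object and an arrow may share a code, since the
      two embeddings are separate.\<close>
    obtain n :: "nat \<Rightarrow> 'i" where n: "inj n"
      using assms(2) infinite_countable_subset by blast
    have "inj (n \<circ> case_pp_obj 0 1)" "inj (n \<circ> case_pp_arr 0 1 2 3)"
      by (intro inj_compose n; auto simp: inj_def split: pp_obj.splits pp_arr.splits)+
    then show ?thesis
      unfolding has_double_equalizers_def
      by (rule has_tightly_discrete_limits_of_embedded_shape[OF lim category_parallel_pair])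
  qed
  ultimately show ?thesis
    using has_tabulators_imp_initial by blast
qed

end
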